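(* Let $(\Lambda V,d)=(\Lambda(U\oplus W),d)$ be a 1-connected, two-stage, elliptic minimal Sullivan model over $\mathbb{Q}$, with $V=U\oplus W$, $dU=0$ and $dW\subset\Lambda U$, such that $V$ has generators of odd degree only, and suppose that $d$ restricts to an isomorphism $d: W\to \Lambda^2U$. Then $\dim_{\mathbb{Q}} H^*(\Lambda V,d)\geq \dim_{\mathbb{Q}} V$.
   Context: For a graded $\mathbb{Q}$-vector space $V$, $\Lambda V$ is the free graded-commutative algebra on $V$, $\Lambda^k V$ is the span of the elements of wordlength $k$, and $\Lambda^{\geq n}V=\bigoplus_{k\geq n}\Lambda^kV$. A minimal Sullivan model is a commutative differential graded algebra $(\Lambda V,d)$ over $\mathbb{Q}$, satisfying the usual Sullivan nilpotence condition, with $dV\subset \Lambda^{\geq 2}V$. It is 1-connected if $V$ is concentrated in degrees $\geq 2$, and elliptic if both $V$ and $H^*(\Lambda V,d)$ are finite dimensional. It is two-stage if $V$ decomposes as a graded vector space $V=U\oplus W$ with $dU=0$ and $dW\subset \Lambda U$. The isomorphism $d:W\to\Lambda^2U$ is a linear isomorphism of degree $+1$. Dimensions are total dimensions over all degrees. *)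

theory Defs
  imports "HOL-Library.Poly_Mapping" "Jordan_Normal_Form.VS_Connect"
begin

section \<open>Rational and graded rational vector spaces\<close>

class rat_vector_space = ab_group_add +
  fixes scaleQ :: "rat \<Rightarrow> 'a \<Rightarrow> 'a"  (infixr \<open>*\<^sub>Q\<close> 75)
  assumes scaleQ_add_right: "c *\<^sub>Q (x + y) = c *\<^sub>Q x + c *\<^sub>Q y"
    and scaleQ_add_left: "(b + c) *\<^sub>Q x = b *\<^sub>Q x + c *\<^sub>Q x"
    and scaleQ_scaleQ: "b *\<^sub>Q c *\<^sub>Q x = (b * c) *\<^sub>Q x"
    and scaleQ_one: "1 *\<^sub>Q x = x"

global_interpretation rvs: vector_space "scaleQ :: rat \<Rightarrow> 'a \<Rightarrow> 'a::rat_vector_space"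
  by unfold_locales (simp_all add: scaleQ_add_right scaleQ_add_left scaleQ_scaleQ scaleQ_one)

text \<open>The last axiom says that the space is the internal direct sum of its homogeneous parts.\<close>

class graded_vector_space = rat_vector_space +
  fixes grade :: "int \<Rightarrow> 'a set"
  assumes grade_zero: "0 \<in> grade n"
    and grade_add: "x \<in> grade n \<Longrightarrow> y \<in> grade n \<Longrightarrow> x + y \<in> grade n"
    and grade_scaleQ: "x \<in> grade n \<Longrightarrow> c *\<^sub>Q x \<in> grade n"
    and grade_direct_sum:
      "\<exists>!f. (\<forall>n. f n \<in> grade n) \<and> finite {n. f n \<noteq> 0} \<and> x = (\<Sum>n | f n \<noteq> 0. f n)"

definition graded_subspace :: "'v::graded_vector_space set \<Rightarrow> bool" where
  "graded_subspace U \<longleftrightarrow> rvs.subspace U \<and> U = rvs.span (\<Union>n. U \<inter> grade n)"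


section \<open>The free graded-commutative algebra \<open>\<Lambda>V\<close>\<close>

text \<open>
  \<open>\<Lambda>V\<close> is the quotient of the tensor algebra \<open>TV\<close> by the two-sided ideal generated by the elements
  \<open>v \<otimes> w - (-1)\<^bsup>|v||w|\<^esup> w \<otimes> v\<close> for homogeneous \<open>v\<close> and \<open>w\<close>. The algebra \<open>TV\<close> itself is presented as
  the monoid algebra over \<open>\<rat>\<close> of the words in the elements of \<open>V\<close>, modulo the linearity relations
  in each letter; both quotients are taken in one step.
\<close>

datatype 'v mword = MWord "'v list"

instantiation mword :: (type) monoid_add
begin

definition zero_mword :: "'a mword" where "0 = MWord []"

fun plus_mword :: "'a mword \<Rightarrow> 'a mword \<Rightarrow> 'a mword" where
  "MWord xs + MWord ys = MWord (xs @ ys)"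

instance
proof
  fix a b c :: "'a mword"
  show "a + b + c = a + (b + c)" by (cases a; cases b; cases c) simp
  show "0 + a = a" by (cases a) (simp add: zero_mword_def)
  show "a + 0 = a" by (cases a) (simp add: zero_mword_def)
qed

end

lemma mword_add_eq_0_iff: "a + b = (0 :: 'a mword) \<longleftrightarrow> a = 0 \<and> b = 0"
  by (cases a; cases b) (simp add: zero_mword_def)

type_synonym 'v word_alg = "'v mword \<Rightarrow>\<^sub>0 rat"

definition letter :: "'v \<Rightarrow> 'v word_alg" where
  "letter v = Poly_Mapping.single (MWord [v]) 1"

abbreviation const :: "rat \<Rightarrow> 'v word_alg" where
  "const c \<equiv> Poly_Mapping.single 0 c"

definition koszul_sign :: "int \<Rightarrow> int \<Rightarrow> rat" where
  "koszul_sign m n = (if odd m \<and> odd n then - 1 else 1)"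

inductive_set Lambda_rel :: "'v::graded_vector_space word_alg set" where
  rel_add: "letter (v + w) - (letter v + letter w) \<in> Lambda_rel"
| rel_scale: "letter (c *\<^sub>Q v) - const c * letter v \<in> Lambda_rel"
| rel_comm: "v \<in> grade m \<Longrightarrow> w \<in> grade n \<Longrightarrow>
    letter v * letter w - const (koszul_sign m n) * (letter w * letter v) \<in> Lambda_rel"

inductive_set Lambda_ideal :: "'v::graded_vector_space word_alg set" where
  ideal_zero: "0 \<in> Lambda_ideal"
| ideal_gen: "r \<in> Lambda_rel \<Longrightarrow> a * r * b \<in> Lambda_ideal"
| ideal_add: "p \<in> Lambda_ideal \<Longrightarrow> q \<in> Lambda_ideal \<Longrightarrow> p + q \<in> Lambda_ideal"

lemma Lambda_ideal_mult_left: "p \<in> Lambda_ideal \<Longrightarrow> a * p \<in> Lambda_ideal"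
proof (induction rule: Lambda_ideal.induct)
  case (ideal_gen r a' b)
  then show ?case using Lambda_ideal.ideal_gen[of r "a * a'" b] by (simp add: mult.assoc)
qed (auto simp: distrib_left intro: Lambda_ideal.intros)

lemma Lambda_ideal_mult_right: "p \<in> Lambda_ideal \<Longrightarrow> p * b \<in> Lambda_ideal"
proof (induction rule: Lambda_ideal.induct)
  case (ideal_gen r a b')
  then show ?case using Lambda_ideal.ideal_gen[of r a "b' * b"] by (simp add: mult.assoc)
qed (auto simp: distrib_right intro: Lambda_ideal.intros)

lemma Lambda_ideal_uminus: "p \<in> Lambda_ideal \<Longrightarrow> - p \<in> Lambda_ideal"
  using Lambda_ideal_mult_left[of p "- 1"] by simp

lemma Lambda_ideal_diff: "p \<in> Lambda_ideal \<Longrightarrow> q \<in> Lambda_ideal \<Longrightarrow> p - q \<in> Lambda_ideal"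
  using ideal_add[OF _ Lambda_ideal_uminus, of p q] by simp

quotient_type (overloaded) 'v Lambda =
  "'v::graded_vector_space word_alg" / "\<lambda>p q. p - q \<in> Lambda_ideal"
proof (rule equivpI)
  show "reflp (\<lambda>p q :: 'v word_alg. p - q \<in> Lambda_ideal)"
    by (simp add: reflp_def ideal_zero)
  show "symp (\<lambda>p q :: 'v word_alg. p - q \<in> Lambda_ideal)"
    unfolding symp_def using Lambda_ideal_uminus by fastforce
  show "transp (\<lambda>p q :: 'v word_alg. p - q \<in> Lambda_ideal)"
    unfolding transp_def using ideal_add by fastforce
qed

lemma lookup_mult_0:
  "Poly_Mapping.lookup (p * q) 0 = Poly_Mapping.lookup p 0 * Poly_Mapping.lookup q 0"
  for p q :: "'v word_alg"
proof -
  have inner: "(\<Sum>r. Poly_Mapping.lookup q r when (0::'v mword) = l + r) =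
      (Poly_Mapping.lookup q 0 when l = 0)" for l
  proof -
    have "(\<lambda>r. Poly_Mapping.lookup q r when (0::'v mword) = l + r) =
        (\<lambda>r. (Poly_Mapping.lookup q 0 when l = 0) when r = 0)"
      using mword_add_eq_0_iff by (fastforce simp: when_def)
    then show ?thesis by (simp only: Sum_any_when_equal)
  qed
  have "Poly_Mapping.lookup (p * q) 0 =
      (\<Sum>l. Poly_Mapping.lookup p l * (\<Sum>r. Poly_Mapping.lookup q r when (0::'v mword) = l + r))"
    by (simp add: times_poly_mapping.rep_eq prod_fun_def)
  also have "\<dots> = (\<Sum>l. (Poly_Mapping.lookup p 0 * Poly_Mapping.lookup q 0) when l = (0::'v mword))"
    unfolding inner by (rule arg_cong[where f = Sum_any]) (auto simp: when_def)
  finally show ?thesis by simp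
qed

lemma lookup_Lambda_ideal_0: "p \<in> Lambda_ideal \<Longrightarrow> Poly_Mapping.lookup p 0 = 0"
proof (induction rule: Lambda_ideal.induct)
  case (ideal_gen r a b)
  have "Poly_Mapping.lookup (letter v) 0 = 0" for v :: 'a
    by (simp add: letter_def lookup_single zero_mword_def)
  with ideal_gen have "Poly_Mapping.lookup r 0 = 0"
    by (auto elim!: Lambda_rel.cases simp: lookup_minus lookup_add lookup_mult_0)
  then show ?case by (simp add: lookup_mult_0)
qed (simp_all add: lookup_add)

instantiation Lambda :: (graded_vector_space) ring_1
begin

lift_definition zero_Lambda :: "'a Lambda" is 0 .
lift_definition one_Lambda :: "'a Lambda" is 1 .
lift_definition plus_Lambda :: "'a Lambda \<Rightarrow> 'a Lambda \<Rightarrow> 'a Lambda" is "(+)"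
  using ideal_add by (fastforce simp: algebra_simps)
lift_definition uminus_Lambda :: "'a Lambda \<Rightarrow> 'a Lambda" is uminus
  using Lambda_ideal_uminus by fastforce
lift_definition minus_Lambda :: "'a Lambda \<Rightarrow> 'a Lambda \<Rightarrow> 'a Lambda" is "(-)"
  using Lambda_ideal_diff by (fastforce simp: algebra_simps)
lift_definition times_Lambda :: "'a Lambda \<Rightarrow> 'a Lambda \<Rightarrow> 'a Lambda" is "(*)"
proof -
  fix p p' q q' :: "'a word_alg"
  assume "p - p' \<in> Lambda_ideal" "q - q' \<in> Lambda_ideal"
  then have "(p - p') * q + p' * (q - q') \<in> Lambda_ideal"
    by (intro ideal_add Lambda_ideal_mult_left Lambda_ideal_mult_right)
  then show "p * q - p' * q' \<in> Lambda_ideal" by (simp add: algebra_simps)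
qed

instance
proof
  show "(0 :: 'a Lambda) \<noteq> 1"
  proof (transfer, rule notI)
    assume "0 - (1 :: 'a word_alg) \<in> Lambda_ideal"
    from lookup_Lambda_ideal_0[OF this] show False by (simp add: lookup_minus)
  qed
qed (transfer; simp add: algebra_simps ideal_zero)+

end

instantiation Lambda :: (graded_vector_space) rat_vector_space
begin

lift_definition scaleQ_Lambda :: "rat \<Rightarrow> 'a Lambda \<Rightarrow> 'a Lambda" is "\<lambda>c p. const c * p"
  using Lambda_ideal_mult_left by (fastforce simp: algebra_simps)

instance
  by (standard; transfer;
      simp add: algebra_simps single_add mult_single ideal_zero flip: mult.assoc)

end

lift_definition incl :: "'v::graded_vector_space \<Rightarrow> 'v Lambda" is letter .

lemma incl_add: "incl (v + w) = incl v + incl w"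
  by transfer (use ideal_gen[OF rel_add, of 1 _ _ 1] in simp)

lemma incl_scale: "incl (c *\<^sub>Q v) = c *\<^sub>Q incl v"
  by transfer (use ideal_gen[OF rel_scale, of 1 _ _ 1] in simp)

lemma incl_graded_commute:
  assumes "v \<in> grade m" "w \<in> grade n"
  shows "incl v * incl w = koszul_sign m n *\<^sub>Q (incl w * incl v)"
  using assms by transfer (use ideal_gen[OF rel_comm, of _ _ _ _ 1 1] in simp)

text \<open>
  \<open>word_product\<close> is the product in \<open>\<Lambda>V\<close> of a list of elements of \<open>V\<close>. For a graded direct summand \<open>U\<close>
  of \<open>V\<close>, the algebra \<open>\<Lambda>U\<close> is identified with the subalgebra \<open>Lambda_of U\<close> of \<open>\<Lambda>V\<close>, and \<open>\<Lambda>\<^sup>kU\<close> with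
  its subspace \<open>Lambda_pow k U\<close>.
\<close>

definition word_product :: "'v::graded_vector_space list \<Rightarrow> 'v Lambda" where
  "word_product vs = prod_list (map incl vs)"

definition Lambda_pow :: "nat \<Rightarrow> 'v::graded_vector_space set \<Rightarrow> 'v Lambda set" where
  "Lambda_pow k U = rvs.span {word_product vs | vs. length vs = k \<and> set vs \<subseteq> U}"

definition Lambda_ge :: "nat \<Rightarrow> 'v::graded_vector_space set \<Rightarrow> 'v Lambda set" where
  "Lambda_ge n U = rvs.span (\<Union>k\<in>{n..}. Lambda_pow k U)"

definition Lambda_of :: "'v::graded_vector_space set \<Rightarrow> 'v Lambda set" where
  "Lambda_of U = rvs.span (\<Union>k. Lambda_pow k U)"

definition Lambda_grade :: "int \<Rightarrow> 'v::graded_vector_space Lambda set" where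
  "Lambda_grade n = rvs.span {word_product (map snd ps) | ps.
     (\<forall>(m, v)\<in>set ps. v \<in> grade m) \<and> sum_list (map fst ps) = n}"


section \<open>Cohomology\<close>

text \<open>
  The quotient of a subspace \<open>Z\<close> by a subspace \<open>B \<subseteq> Z\<close>, with the cosets of \<open>B\<close> as elements. The
  fields \<open>mult\<close> and \<open>one\<close> of a module record carry no information about a vector space.
\<close>

definition coset :: "'a::rat_vector_space set \<Rightarrow> 'a \<Rightarrow> 'a set" where
  "coset B x = (\<lambda>b. x + b) ` B"

definition quotient_space ::
    "'a::rat_vector_space set \<Rightarrow> 'a set \<Rightarrow> (rat, 'a set) module" where
  "quotient_space Z B = \<lparr>carrier = coset B ` Z, mult = undefined, one = undefined,
     zero = coset B 0, add = (\<lambda>X Y. \<Union>x\<in>X. \<Union>y\<in>Y. coset B (x + y)),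
     smult = (\<lambda>c X. \<Union>x\<in>X. coset B (c *\<^sub>Q x))\<rparr>"

definition cohomology :: "('a::rat_vector_space \<Rightarrow> 'a) \<Rightarrow> (rat, 'a set) module" where
  "cohomology d = quotient_space {z. d z = 0} (range d)"

lemma coset_eq_iff:
  assumes "rvs.subspace B"
  shows "coset B x = coset B y \<longleftrightarrow> x - y \<in> B"
proof
  assume "coset B x = coset B y"
  moreover have "x \<in> coset B x"
    using rvs.subspace_0[OF assms] by (auto simp: coset_def image_iff)
  ultimately obtain b where "b \<in> B" "x = y + b" by (auto simp: coset_def)
  then show "x - y \<in> B" by simp
next
  assume xy: "x - y \<in> B"
  have "x + b = y + ((x - y) + b)" "y + b = x + (b - (x - y))" for b by simp_all
  moreover have "(x - y) + b \<in> B" "b - (x - y) \<in> B" if "b \<in> B" for b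
    using that xy assms by (auto intro: rvs.subspace_add rvs.subspace_diff)
  ultimately show "coset B x = coset B y" unfolding coset_def by blast
qed

lemma quotient_space_add:
  assumes "rvs.subspace B"
  shows "coset B x \<oplus>\<^bsub>quotient_space Z B\<^esub> coset B y = coset B (x + y)"
proof -
  have "coset B (x + a + (y + b)) = coset B (x + y)" if "a \<in> B" "b \<in> B" for a b
    using that rvs.subspace_add[OF assms] by (simp add: coset_eq_iff[OF assms] algebra_simps)
  moreover have "B \<noteq> {}" using rvs.subspace_0[OF assms] by blast
  ultimately show ?thesis
    unfolding quotient_space_def by (simp add: coset_def[of B x] coset_def[of B y])
qed

lemma quotient_space_smult:
  assumes "rvs.subspace B"
  shows "c \<odot>\<^bsub>quotient_space Z B\<^esub> coset B x = coset B (c *\<^sub>Q x)"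
proof -
  have "coset B (c *\<^sub>Q (x + a)) = coset B (c *\<^sub>Q x)" if "a \<in> B" for a
    using that rvs.subspace_scale[OF assms]
    by (simp add: coset_eq_iff[OF assms] scaleQ_add_right)
  moreover have "B \<noteq> {}" using rvs.subspace_0[OF assms] by blast
  ultimately show ?thesis
    unfolding quotient_space_def by (simp add: coset_def[of B x])
qed

lemma vectorspace_quotient_space:
  assumes Z: "rvs.subspace Z" and B: "rvs.subspace B"
  shows "vectorspace class_ring (quotient_space Z B)"
proof -
  let ?Q = "quotient_space Z B"
  have car: "carrier ?Q = coset B ` Z" and zero: "\<zero>\<^bsub>?Q\<^esub> = coset B 0"
    by (simp_all add: quotient_space_def)
  note sm = quotient_space_add[OF B] quotient_space_smult[OF B]
  have field: "Ring.field (class_ring :: rat ring)"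
    by (rule class_field.field_axioms)
  have "abelian_group ?Q"
  proof (rule abelian_groupI)
    fix X assume "X \<in> carrier ?Q"
    then obtain x where x: "x \<in> Z" "X = coset B x" by (auto simp: car)
    then show "\<exists>Y\<in>carrier ?Q. Y \<oplus>\<^bsub>?Q\<^esub> X = \<zero>\<^bsub>?Q\<^esub>"
      by (intro bexI[of _ "coset B (- x)"]) (auto simp: car zero sm rvs.subspace_neg[OF Z])
  qed (auto simp: car zero sm add_ac rvs.subspace_add[OF Z] rvs.subspace_0[OF Z])
  then have "module class_ring ?Q"
    by (intro moduleI class_cring.cring_axioms)
      (auto simp: car sm rvs.subspace_scale[OF Z] scaleQ_add_left scaleQ_add_right
        scaleQ_scaleQ scaleQ_one)
  with field show ?thesis by (simp add: vectorspace_def)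
qed


lemma vectorspace_cohomology:
  assumes "Vector_Spaces.linear scaleQ scaleQ d"
  shows "vectorspace class_ring (cohomology d)"
proof -
  interpret Vector_Spaces.linear scaleQ scaleQ d by (rule assms)
  show ?thesis
    unfolding cohomology_def
    by (intro vectorspace_quotient_space subspace_kernel subspace_image rvs.subspace_UNIV)
qed


section \<open>Sullivan models\<close>

definition cdga_differential :: "('v::graded_vector_space Lambda \<Rightarrow> 'v Lambda) \<Rightarrow> bool" where
  "cdga_differential d \<longleftrightarrow>
     Vector_Spaces.linear scaleQ scaleQ d \<and>
     (\<forall>n. \<forall>x\<in>Lambda_grade n. d x \<in> Lambda_grade (n + 1)) \<and>
     (\<forall>x. d (d x) = 0) \<and>
     (\<forall>m. \<forall>x\<in>Lambda_grade m. \<forall>y. d (x * y) = d x * y + (if odd m then - (x * d y) else x * d y))"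

definition sullivan_nilpotent :: "('v::graded_vector_space Lambda \<Rightarrow> 'v Lambda) \<Rightarrow> bool" where
  "sullivan_nilpotent d \<longleftrightarrow>
     (\<exists>F :: nat \<Rightarrow> 'v set. (\<forall>k. graded_subspace (F k)) \<and> (\<forall>k. F k \<subseteq> F (Suc k)) \<and>
        (\<Union>k. F k) = UNIV \<and> (\<forall>v\<in>F 0. d (incl v) = 0) \<and>
        (\<forall>k. \<forall>v\<in>F (Suc k). d (incl v) \<in> Lambda_of (F k)))"

definition minimal_sullivan_model :: "('v::graded_vector_space Lambda \<Rightarrow> 'v Lambda) \<Rightarrow> bool" where
  "minimal_sullivan_model d \<longleftrightarrow>
     cdga_differential d \<and> sullivan_nilpotent d \<and> (\<forall>v. d (incl v) \<in> Lambda_ge 2 UNIV)"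

definition one_connected :: "('v::graded_vector_space Lambda \<Rightarrow> 'v Lambda) \<Rightarrow> bool" where
  "one_connected d \<longleftrightarrow> (\<forall>n<2. (grade n :: 'v set) = {0})"

definition elliptic :: "('v::graded_vector_space Lambda \<Rightarrow> 'v Lambda) \<Rightarrow> bool" where
  "elliptic d \<longleftrightarrow>
     (\<exists>S :: 'v set. finite S \<and> rvs.span S = UNIV) \<and>
     vectorspace.fin_dim class_ring (cohomology d)"

definition graded_decomposition :: "'v::graded_vector_space set \<Rightarrow> 'v set \<Rightarrow> bool" where
  "graded_decomposition U W \<longleftrightarrow>
     graded_subspace U \<and> graded_subspace W \<and> U \<inter> W = {0} \<and> {u + w | u w. u \<in> U \<and> w \<in> W} = UNIV"

definition two_stage ::
    "('v::graded_vector_space Lambda \<Rightarrow> 'v Lambda) \<Rightarrow> 'v set \<Rightarrow> 'v set \<Rightarrow> bool" where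
  "two_stage d U W \<longleftrightarrow>
     graded_decomposition U W \<and> (\<forall>u\<in>U. d (incl u) = 0) \<and> (\<forall>w\<in>W. d (incl w) \<in> Lambda_of U)"

end

theory Submission
  imports Defs
begin

text \<open>
  As all generators have odd degree, \<open>\<Lambda>V\<close> is an exterior algebra. Let \<open>B\<^sub>U\<close> be a basis of \<open>U\<close>. Since
  \<open>d : W \<rightarrow> \<Lambda>\<^sup>2U\<close> is an isomorphism, \<open>W\<close> has a basis of elements \<open>w\<close> with \<open>d w = b b'\<close> for some
  \<open>b, b' \<in> B\<^sub>U\<close>, and then \<open>d (b w) = - b b b' = 0\<close>. So every \<open>u \<in> B\<^sub>U\<close> gives the cocycle \<open>u\<close>, and every
  basis element \<open>w\<close> of \<open>W\<close> gives the cocycle \<open>b w\<close>; together these are \<open>dim V\<close> many. All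
  coboundaries lie in the ideal generated by \<open>U \<cdot> U\<close>. The linear map \<open>\<Lambda>V \<rightarrow> V\<close> that projects \<open>V\<close>
  to \<open>U\<close>, sends each cocycle \<open>b w = - w b\<close> to \<open>w\<close>, all other products of two basis elements to \<open>0\<close>,
  and vanishes on the other wordlengths kills this ideal and maps the chosen cocycles to a basis
  of \<open>V\<close>. Hence their classes are linearly independent.
\<close>

section \<open>Linear maps on \<open>\<Lambda>V\<close>\<close>

lemma word_alg_induct [case_names single add]:
  fixes p :: "'v word_alg"
  assumes single: "\<And>vs c. P (Poly_Mapping.single (MWord vs) c)"
    and add: "\<And>p q. P p \<Longrightarrow> P q \<Longrightarrow> P (p + q)"
  shows "P p"
proof (induction p rule: Poly_Mapping.update_induct)
  case const
  show ?case using single[of "[]" 0] by simp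
next
  case (update f a b)
  have "Poly_Mapping.update a b f = f + Poly_Mapping.single a b"
    using update.hyps(1)
    by (intro poly_mapping_eqI)
      (auto simp: lookup_update lookup_add lookup_single when_def in_keys_iff)
  then show ?case using add[OF update.IH] single by (cases a) simp
qed

lemma abs_Lambda_single: "abs_Lambda (Poly_Mapping.single (MWord vs) c) = c *\<^sub>Q word_product vs"
proof -
  have "abs_Lambda (Poly_Mapping.single (MWord vs) 1) = word_product vs"
  proof (induction vs)
    case Nil
    show ?case by (simp add: word_product_def one_Lambda.abs_eq flip: zero_mword_def single_one)
  next
    case (Cons v vs)
    have "Poly_Mapping.single (MWord (v # vs)) (1::rat)
        = letter v * Poly_Mapping.single (MWord vs) 1"
      by (simp add: letter_def mult_single)
    then show ?case
      using Cons by (simp add: word_product_def incl.abs_eq times_Lambda.abs_eq[symmetric])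
  qed
  moreover have "Poly_Mapping.single (MWord vs) c = const c * Poly_Mapping.single (MWord vs) 1"
    by (simp add: mult_single)
  ultimately show ?thesis by (simp add: scaleQ_Lambda.abs_eq[symmetric])
qed

text \<open>Words span the tensor algebra, so their classes span \<Lambda>V. Linear statements about
  \<Lambda>V can therefore be checked on products of generators.\<close>

lemma Lambda_induct [case_names word add]:
  fixes x :: "'v::graded_vector_space Lambda"
  assumes word: "\<And>c vs. P (c *\<^sub>Q word_product vs)" and add: "\<And>x y. P x \<Longrightarrow> P y \<Longrightarrow> P (x + y)"
  shows "P x"
proof -
  have "P (abs_Lambda p)" for p
    by (induction p rule: word_alg_induct)
      (auto simp: abs_Lambda_single word plus_Lambda.abs_eq[symmetric] add)
  then show ?thesis by (induction x) auto
qed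

lemma scaleQ_mult_left: "(c *\<^sub>Q x) * y = c *\<^sub>Q (x * y)" for x y :: "'v::graded_vector_space Lambda"
  by transfer (simp add: mult.assoc ideal_zero)

lemma word_alg_const_commute: "p * const c = const c * p" for p :: "'v word_alg"
  by (induction p rule: word_alg_induct) (simp_all add: mult_single algebra_simps)

lemma scaleQ_mult_right: "x * (c *\<^sub>Q y) = c *\<^sub>Q (x * y)" for x y :: "'v::graded_vector_space Lambda"
  by transfer (simp add: word_alg_const_commute ideal_zero flip: mult.assoc)

text \<open>The universal property of \<Lambda>V as a vector space. The three hypotheses say that
  the linear extension of \<open>g\<close> kills every generating relation placed between two words,
  hence the whole ideal. Nothing multiplicative is asked of \<open>g\<close>, so maps that are not
  algebra homomorphisms can be built.\<close>

lemma Lambda_linear_extension: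
  fixes g :: "'v::graded_vector_space list \<Rightarrow> 'b::rat_vector_space"
  assumes g_add: "\<And>xs v w ys. g (xs @ (v + w) # ys) = g (xs @ v # ys) + g (xs @ w # ys)"
    and g_scale: "\<And>xs c v ys. g (xs @ (c *\<^sub>Q v) # ys) = c *\<^sub>Q g (xs @ v # ys)"
    and g_comm: "\<And>xs v m w n ys. v \<in> grade m \<Longrightarrow> w \<in> grade n \<Longrightarrow>
      g (xs @ v # w # ys) = koszul_sign m n *\<^sub>Q g (xs @ w # v # ys)"
  obtains F where "Vector_Spaces.linear scaleQ scaleQ F" "\<And>vs. F (word_product vs) = g vs"
proof -
  define h where "h k = (case k of MWord vs \<Rightarrow> g vs)" for k
  define G where "G p = (\<Sum>k\<in>Poly_Mapping.keys p. Poly_Mapping.lookup p k *\<^sub>Q h k)"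
    for p :: "'v word_alg"
  \<comment> \<open>Enlarging the index set beyond the support adds only zero terms; this lets sums
    with different supports be compared over their union.\<close>
  have G_eq: "G p = (\<Sum>k\<in>S. Poly_Mapping.lookup p k *\<^sub>Q h k)"
    if "finite S" "Poly_Mapping.keys p \<subseteq> S" for p S
    unfolding G_def using that by (intro sum.mono_neutral_left) (auto simp: in_keys_iff)
  have G_single: "G (Poly_Mapping.single (MWord vs) c) = c *\<^sub>Q g vs" for vs c
    using G_eq[of "{MWord vs}" "Poly_Mapping.single (MWord vs) c"] by (auto simp: h_def)
  have G_add: "G (p + q) = G p + G q" for p q
    using G_eq[of "Poly_Mapping.keys p \<union> Poly_Mapping.keys q" p]
      G_eq[of "Poly_Mapping.keys p \<union> Poly_Mapping.keys q" q]
      G_eq[of "Poly_Mapping.keys p \<union> Poly_Mapping.keys q" "p + q"] keys_add[of p q]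
    by (simp add: lookup_add scaleQ_add_left sum.distrib)
  have G_scale: "G (const c * p) = c *\<^sub>Q G p" for c p
  proof (induction p rule: word_alg_induct)
    case (single vs b)
    have "const c * Poly_Mapping.single (MWord vs) b = Poly_Mapping.single (MWord vs) (c * b)"
      by (simp add: mult_single)
    then show ?case by (simp add: G_single scaleQ_scaleQ)
  qed (simp add: distrib_left G_add scaleQ_add_right)
  have G_diff: "G (p - q) = G p - G q" for p q
    using G_add[of "p - q" q] by simp
  \<comment> \<open>Both outer factors of an ideal generator are sums of monomials, so the relations
    need testing only between monomials.\<close>
  have G_rel: "G (Poly_Mapping.single (MWord xs) b * r * Poly_Mapping.single (MWord ys) c) = 0"
    if "r \<in> Lambda_rel" for xs ys b c r
    using that
  proof cases
    case (rel_add v w)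
    show ?thesis unfolding rel_add
      by (simp add: letter_def distrib_left distrib_right left_diff_distrib right_diff_distrib
        mult_single G_diff G_add G_single g_add scaleQ_add_right)
  next
    case (rel_scale e v)
    have "const e * letter v = Poly_Mapping.single (MWord [v]) e"
      by (simp add: letter_def mult_single)
    then show ?thesis unfolding rel_scale
      by (simp add: letter_def left_diff_distrib right_diff_distrib
        mult_single G_diff G_single g_scale scaleQ_scaleQ ac_simps)
  next
    case (rel_comm v m w n)
    have "letter v * letter w = Poly_Mapping.single (MWord [v, w]) 1"
      "const (koszul_sign m n) * (letter w * letter v)
        = Poly_Mapping.single (MWord [w, v]) (koszul_sign m n)"
      by (simp_all add: letter_def mult_single)
    then show ?thesis unfolding rel_comm(1)
      using g_comm[OF rel_comm(2,3), of xs ys]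
      by (simp add: left_diff_distrib right_diff_distrib
        mult_single G_diff G_single scaleQ_scaleQ ac_simps)
  qed
  have G_gen: "G (p * r * q) = 0" if "r \<in> Lambda_rel" for p q r
  proof (induction p rule: word_alg_induct)
    case (single xs b)
    show ?case
      by (induction q rule: word_alg_induct)
        (simp_all add: G_rel[OF that] distrib_left G_add)
  qed (simp add: distrib_right G_add)
  have G_ideal: "G p = 0" if "p \<in> Lambda_ideal" for p
    using that by induction (auto simp: G_gen G_add, simp add: G_def)
  define F where "F x = G (rep_Lambda x)" for x
  have F_abs: "F (abs_Lambda p) = G p" for p
  proof -
    have "rep_Lambda (abs_Lambda p) - p \<in> Lambda_ideal"
      using Quotient3_rep_abs[OF Quotient3_Lambda] ideal_zero by fastforce
    from G_ideal[OF this] show ?thesis by (simp add: F_def G_diff)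
  qed
  have "F (x + y) = F x + F y" for x y
    by (induction x, induction y) (simp add: plus_Lambda.abs_eq F_abs G_add)
  moreover have "F (c *\<^sub>Q x) = c *\<^sub>Q F x" for c x
    by (induction x) (simp add: scaleQ_Lambda.abs_eq F_abs G_scale)
  ultimately have "Vector_Spaces.linear scaleQ scaleQ F" by unfold_locales auto
  moreover have "F (word_product vs) = g vs" for vs
    using F_abs[of "Poly_Mapping.single (MWord vs) 1"]
    by (simp add: abs_Lambda_single G_single scaleQ_one)
  ultimately show ?thesis by (rule that)
qed

text \<open>The defining relations preserve wordlength, so a linear map may be prescribed in each
  wordlength separately: here \<alpha> in length one, \<beta> in length two, and zero
  elsewhere.\<close>

lemma Lambda_linear_extension_short:
  fixes \<alpha> :: "'v::graded_vector_space \<Rightarrow> 'b::rat_vector_space"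
  assumes "Vector_Spaces.linear scaleQ scaleQ \<alpha>"
    and \<beta>: "\<And>v. Vector_Spaces.linear scaleQ scaleQ (\<beta> v)"
    and sym: "\<And>v w m n. v \<in> grade m \<Longrightarrow> w \<in> grade n \<Longrightarrow> \<beta> v w = koszul_sign m n *\<^sub>Q \<beta> w v"
    and \<beta>': "\<And>w. Vector_Spaces.linear scaleQ scaleQ (\<lambda>v. \<beta> v w)"
  obtains F where "Vector_Spaces.linear scaleQ scaleQ F"
    "\<And>v. F (incl v) = \<alpha> v" "\<And>v w. F (incl v * incl w) = \<beta> v w"
    "\<And>vs. length vs > 2 \<Longrightarrow> F (word_product vs) = 0"
proof -
  interpret \<alpha>: Vector_Spaces.linear scaleQ scaleQ \<alpha> by fact
  interpret \<beta>: Vector_Spaces.linear scaleQ scaleQ "\<beta> v" for v by fact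
  interpret \<beta>': Vector_Spaces.linear scaleQ scaleQ "\<lambda>v. \<beta> v w" for w by fact
  define g where "g vs = (case vs of [v] \<Rightarrow> \<alpha> v | [v, w] \<Rightarrow> \<beta> v w | _ \<Rightarrow> 0)" for vs
  have g_simps: "g [v] = \<alpha> v" "g [v, w] = \<beta> v w" for v w by (simp_all add: g_def)
  have g_zero: "g vs = 0" if "length vs > 2" for vs
    using that by (auto simp: g_def split: list.split)
  \<comment> \<open>A letter between \<open>xs\<close> and \<open>ys\<close> is a whole word, the
    first or second letter of a word of length two, or part of a word of length at least three,
    where \<open>g\<close> vanishes.\<close>
  have cases: "(xs = [] \<and> ys = []) \<or> (\<exists>u. xs = [] \<and> ys = [u]) \<or> (\<exists>u. xs = [u] \<and> ys = [])
      \<or> length xs + length ys > 1" for xs ys :: "'v list"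
    by (cases xs rule: remdups_adj.cases; cases ys rule: remdups_adj.cases) auto
  show ?thesis
  proof (rule Lambda_linear_extension[of g])
    show "g (xs @ (v + w) # ys) = g (xs @ v # ys) + g (xs @ w # ys)" for xs v w ys
      using cases[of xs ys] by (auto simp: g_simps g_zero \<alpha>.add \<beta>.add \<beta>'.add)
    show "g (xs @ (c *\<^sub>Q v) # ys) = c *\<^sub>Q g (xs @ v # ys)" for xs c v ys
      using cases[of xs ys] by (auto simp: g_simps g_zero \<alpha>.scale \<beta>.scale \<beta>'.scale)
    show "g (xs @ v # w # ys) = koszul_sign m n *\<^sub>Q g (xs @ w # v # ys)"
      if "v \<in> grade m" "w \<in> grade n" for xs v m w n ys
    proof (cases "xs = [] \<and> ys = []")
      case True
      then show ?thesis by (simp add: g_simps sym[OF that])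
    next
      case False
      then have "length xs + length ys > 0" by auto
      then show ?thesis by (simp add: g_zero)
    qed
  next
    fix F
    assume F: "Vector_Spaces.linear scaleQ scaleQ F" "\<And>vs. F (word_product vs) = g vs"
    show thesis
    proof (rule that[of F])
      show "F (incl v) = \<alpha> v" for v using F(2)[of "[v]"] by (simp add: word_product_def g_simps)
      show "F (incl v * incl w) = \<beta> v w" for v w
        using F(2)[of "[v, w]"] by (simp add: word_product_def g_simps)
    qed (simp_all add: F g_zero)
  qed
qed


section \<open>A lower bound for the dimension of cohomology\<close>

lemma dim_cohomology_ge_card:
  fixes d :: "'a::rat_vector_space \<Rightarrow> 'a" and F :: "'a \<Rightarrow> 'b::rat_vector_space"
  assumes d: "Vector_Spaces.linear scaleQ scaleQ d"
    and fin: "vectorspace.fin_dim class_ring (cohomology d)"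
    and F: "Vector_Spaces.linear scaleQ scaleQ F" and Fd: "\<And>x. F (d x) = 0"
    and C: "\<And>c. c \<in> C \<Longrightarrow> d c = 0" and inj: "inj_on F C" and indep: "rvs.independent (F ` C)"
  shows "card C \<le> vectorspace.dim class_ring (cohomology d)"
proof -
  interpret d: Vector_Spaces.linear scaleQ scaleQ d by (rule d)
  interpret F: Vector_Spaces.linear scaleQ scaleQ F by (rule F)
  interpret H: vectorspace class_ring "cohomology d" by (rule vectorspace_cohomology[OF d])
  let ?q = "coset (range d)"
  have R: "rvs.subspace (range d)" by (intro d.subspace_image rvs.subspace_UNIV)
  have q_eq: "F x = F y" if "?q x = ?q y" for x y
  proof -
    obtain z where "x - y = d z" using \<open>?q x = ?q y\<close> coset_eq_iff[OF R] by blast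
    then show ?thesis using Fd[of z] F.diff[of x y] by simp
  qed
  have q_car: "?q c \<in> carrier (cohomology d)" if "c \<in> C" for c
    using C[OF that] by (auto simp: cohomology_def quotient_space_def)
  have q_inj: "inj_on ?q C" using q_eq inj by (meson inj_onD inj_onI)
  \<comment> \<open>\<open>H.lincomb\<close> takes its coefficients on classes and sums over a set
    of classes; \<open>q_inj\<close> ensures that no two elements of \<open>S\<close> are
    merged.\<close>
  have lincomb: "H.lincomb a (?q ` S) = ?q (\<Sum>c\<in>S. a (?q c) *\<^sub>Q c)"
    if "finite S" "S \<subseteq> C" for a S
    using that
  proof (induction S)
    case empty
    show ?case by (simp add: H.lincomb_def) (simp add: cohomology_def quotient_space_def)
  next
    case (insert c S)
    have "?q c \<notin> ?q ` S" using insert.hyps insert.prems q_inj by (auto dest: inj_onD)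
    then have "H.lincomb a (?q ` insert c S)
        = (a (?q c) \<odot>\<^bsub>cohomology d\<^esub> ?q c) \<oplus>\<^bsub>cohomology d\<^esub> H.lincomb a (?q ` S)"
      unfolding H.lincomb_def image_insert using insert.hyps insert.prems q_car
      by (intro H.finsum_insert) (auto intro!: H.smult_closed)
    also have "\<dots> = ?q (\<Sum>c\<in>insert c S. a (?q c) *\<^sub>Q c)"
      using insert by (simp add: cohomology_def quotient_space_add[OF R] quotient_space_smult[OF R])
    finally show ?case .
  qed
  have "H.lin_indpt (?q ` C)"
  proof
    assume "H.lin_dep (?q ` C)"
    then obtain A a X where A: "finite A" "A \<subseteq> ?q ` C"
      and zero: "H.lincomb a A = \<zero>\<^bsub>cohomology d\<^esub>" and X: "X \<in> A" "a X \<noteq> 0"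
      unfolding H.lin_dep_def by auto
    obtain S where S: "S \<subseteq> C" "finite S" "A = ?q ` S"
      using finite_subset_image[OF A] by blast
    obtain c where c: "c \<in> S" "X = ?q c" using X S by blast
    have "?q (\<Sum>c\<in>S. a (?q c) *\<^sub>Q c) = ?q 0"
      using zero lincomb[OF S(2,1), of a] S(3) by (simp add: cohomology_def quotient_space_def)
    from q_eq[OF this] have "(\<Sum>c\<in>S. a (?q c) *\<^sub>Q F c) = 0" by (simp add: F.sum F.scale)
    moreover have injS: "inj_on F S" using inj S(1) inj_on_subset by blast
    ultimately have "(\<Sum>v\<in>F ` S. a (?q (inv_into S F v)) *\<^sub>Q v) = 0"
      by (simp add: sum.reindex)
    then have "a (?q (inv_into S F (F c))) = 0"
      by (rule rvs.independentD[OF indep, rotated 2]) (use S c(1) in auto)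
    then show False using X(2) c injS by simp
  qed
  then have "card (?q ` C) \<le> H.dim" using q_car by (intro H.li_le_dim(2)[OF fin]) auto
  then show ?thesis by (simp add: card_image[OF q_inj])
qed


section \<open>Generators of odd degree\<close>

lemma span_homogeneous: "rvs.span (\<Union>n. grade n) = (UNIV :: 'v::graded_vector_space set)"
proof -
  have "x \<in> rvs.span (\<Union>n. grade n)" for x :: 'v
  proof -
    obtain f where f: "\<forall>n. f n \<in> (grade n :: 'v set)" "x = (\<Sum>n | f n \<noteq> 0. f n)"
      using grade_direct_sum[of x] by blast
    show ?thesis unfolding f(2) using f(1) by (intro rvs.span_sum rvs.span_base) auto
  qed
  then show ?thesis by auto
qed

lemma incl_in_Lambda_grade: "v \<in> grade n \<Longrightarrow> incl v \<in> Lambda_grade n"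
  unfolding Lambda_grade_def
  by (intro rvs.span_base CollectI exI[of _ "[(n, v)]"]) (auto simp: word_product_def)

lemma incl_zero: "incl 0 = 0"
  using incl_add[of 0 0] by simp

context
  assumes odd_generators: "\<forall>n. even n \<longrightarrow> (grade n :: 'v::graded_vector_space set) = {0}"
begin

text \<open>Homogeneous generators anticommute: both have odd degree or one of them is zero.
  Bilinearity extends this to all of \<open>V\<close>, and twice the square being zero suffices over
  the rationals.\<close>

lemma incl_square_zero: "incl v * incl v = 0" for v :: 'v
proof -
  have half: "x = 0" if "x + x = 0" for x :: "'v Lambda"
  proof -
    have "x = (1/2) *\<^sub>Q (x + x)"
      by (simp add: scaleQ_one scaleQ_add_right flip: scaleQ_add_left)
    then show ?thesis using that rvs.scale_zero_right[of "1/2"] by metis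
  qed
  have anti: "incl v * incl w + incl w * incl v = 0" for v w :: 'v
  proof -
    have hom: "incl v * incl w + incl w * incl v = 0" if "v \<in> grade m" "w \<in> grade n"
      for v w :: 'v and m n
    proof (cases "odd m \<and> odd n")
      case True
      then show ?thesis
        using incl_graded_commute[OF that] by (simp add: koszul_sign_def scaleQ_one)
    next
      case False
      then have "v = 0 \<or> w = 0" using that odd_generators by blast
      then show ?thesis by (auto simp: incl_zero)
    qed
    have hom': "incl v * incl w + incl w * incl v = 0" if "v \<in> grade m" for v w :: 'v and m
    proof -
      have "w \<in> rvs.span (\<Union>n. grade n)" by (simp add: span_homogeneous)
      then show ?thesis
      proof (induction rule: rvs.span_induct_alt)
        case (step c x y)
        then obtain n where "x \<in> grade n" by blast
        then have "c *\<^sub>Q (incl v * incl x + incl x * incl v) = 0" using hom[OF that] by simp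
        then show ?case
          using step(2) by (simp add: incl_add incl_scale distrib_left distrib_right
            scaleQ_mult_left scaleQ_mult_right scaleQ_add_right add.assoc)
            (metis add.left_commute add.right_neutral)
      qed (simp add: incl_zero)
    qed
    have "v \<in> rvs.span (\<Union>n. grade n)" by (simp add: span_homogeneous)
    then show ?thesis
    proof (induction rule: rvs.span_induct_alt)
      case (step c x y)
      then obtain n where "x \<in> grade n" by blast
      then have "c *\<^sub>Q (incl x * incl w + incl w * incl x) = 0" using hom' by simp
      then show ?case
        using step(2) by (simp add: incl_add incl_scale distrib_left distrib_right
            scaleQ_mult_left scaleQ_mult_right scaleQ_add_right add.assoc)
            (metis add.left_commute add.right_neutral)
    qed (simp add: incl_zero)
  qed
  from half[OF anti] show ?thesis .
qed

text \<open>The Leibniz sign is the same for all homogeneous parts of \<open>v\<close>, because only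
  odd degrees occur; both sides are linear in \<open>v\<close>, so \<open>v\<close> need not be
  homogeneous.\<close>

lemma derivation_incl:
  fixes v :: 'v
  assumes "cdga_differential d"
  shows "d (incl v * y) = d (incl v) * y - incl v * d y"
proof -
  interpret d: Vector_Spaces.linear scaleQ scaleQ d
    using assms by (simp add: cdga_differential_def)
  have "v \<in> rvs.span (\<Union>n. grade n)" by (simp add: span_homogeneous)
  then show ?thesis
  proof (induction rule: rvs.span_induct_alt)
    case base
    show ?case by (simp add: incl_zero)
  next
    case (step c x z)
    then obtain n where x: "x \<in> grade n" by blast
    have "d (incl x * y) = d (incl x) * y - incl x * d y"
    proof (cases "odd n")
      case True
      then show ?thesis
        using assms incl_in_Lambda_grade[OF x] by (simp add: cdga_differential_def)
    next
      case False
      then have "x = 0" using odd_generators x by blast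
      then show ?thesis by (simp add: incl_zero)
    qed
    then have "c *\<^sub>Q d (incl x * y) = c *\<^sub>Q (d (incl x) * y) - c *\<^sub>Q (incl x * d y)"
      by (simp add: rvs.scale_right_diff_distrib)
    then show ?case
      using step(2) by (simp add: incl_add incl_scale distrib_right d.add d.scale scaleQ_mult_left)
  qed
qed

end

section \<open>An ideal that contains all coboundaries\<close>

lemma differential_one:
  assumes "cdga_differential d"
  shows "d 1 = 0"
proof -
  have "1 \<in> Lambda_grade 0"
    unfolding Lambda_grade_def
    by (intro rvs.span_base CollectI exI[of _ "[]"]) (auto simp: word_product_def)
  then have "d (1 * 1) = d 1 * 1 + (if odd (0::int) then - (1 * d 1) else 1 * d 1)"
    using assms unfolding cdga_differential_def by blast
  then show ?thesis by simp
qed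

text \<open>The two-sided ideal generated by the products of two elements of \<open>U\<close>.
  Taking words as outer factors makes each spanning element a single word product, on which a linear
  map given on words can be evaluated.\<close>

definition square_ideal :: "'v::graded_vector_space set \<Rightarrow> 'v Lambda set" where
  "square_ideal U = rvs.span {word_product xs * (incl u * incl u') * word_product ys
     | xs u u' ys. u \<in> U \<and> u' \<in> U}"

lemma square_ideal_mult_left: "y \<in> square_ideal U \<Longrightarrow> x * y \<in> square_ideal U"
proof (induction x rule: Lambda_induct)
  case (word c vs)
  from word show ?case unfolding square_ideal_def
  proof (induction rule: rvs.span_induct_alt)
    case (step b x y)
    from step(1) obtain xs u u' ys
      where x: "x = word_product xs * (incl u * incl u') * word_product ys" and u: "u \<in> U" "u' \<in> U"
      by blast
    have "word_product vs * x = word_product (vs @ xs) * (incl u * incl u') * word_product ys"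
      by (simp add: x word_product_def mult.assoc)
    then have "word_product vs * x \<in> rvs.span {word_product xs * (incl u * incl u') * word_product ys
        | xs u u' ys. u \<in> U \<and> u' \<in> U}"
      using u by (intro rvs.span_base) blast
    with step(2) show ?case
      by (simp add: distrib_left scaleQ_mult_left scaleQ_mult_right scaleQ_add_right
        rvs.span_add rvs.span_scale)
  qed (simp add: rvs.span_zero)
next
  case (add x1 x2)
  then show ?case by (simp add: distrib_right square_ideal_def rvs.span_add)
qed

lemma square_ideal_mult_right: "x \<in> square_ideal U \<Longrightarrow> x * y \<in> square_ideal U"
proof (induction y rule: Lambda_induct)
  case (word c vs)
  from word show ?case unfolding square_ideal_def
  proof (induction rule: rvs.span_induct_alt)
    case (step b x y)
    from step(1) obtain xs u u' ys
      where x: "x = word_product xs * (incl u * incl u') * word_product ys" and u: "u \<in> U" "u' \<in> U"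
      by blast
    have "x * word_product vs = word_product xs * (incl u * incl u') * word_product (ys @ vs)"
      by (simp add: x word_product_def mult.assoc)
    then have "x * word_product vs \<in> rvs.span {word_product xs * (incl u * incl u') * word_product ys
        | xs u u' ys. u \<in> U \<and> u' \<in> U}"
      using u by (intro rvs.span_base) blast
    with step(2) show ?case
      by (simp add: distrib_right scaleQ_mult_left scaleQ_mult_right scaleQ_add_right
        rvs.span_add rvs.span_scale)
  qed (simp add: rvs.span_zero)
next
  case (add x1 x2)
  then show ?case by (simp add: distrib_left square_ideal_def rvs.span_add)
qed

lemma Lambda_pow_2_subset_square_ideal: "Lambda_pow 2 U \<subseteq> square_ideal U"
  unfolding Lambda_pow_def square_ideal_def
proof (rule rvs.span_mono, safe)
  fix vs assume vs: "length vs = 2" "set vs \<subseteq> U"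
  then obtain u u' where uu: "vs = [u, u']" by (auto simp: length_Suc_conv numeral_2_eq_2)
  show "\<exists>xs u u' ys. word_product vs = word_product xs * (incl u * incl u') * word_product ys
      \<and> u \<in> U \<and> u' \<in> U"
    using vs uu by (intro exI[of _ "[]"] exI[of _ u] exI[of _ u']) (simp add: word_product_def)
qed

text \<open>Peeling off the first letter of a word, the Leibniz rule leaves one term with a factor
  \<open>d (incl v)\<close> and one with the differential of a shorter word; an ideal absorbs the
  remaining factors.\<close>

lemma range_differential_subset_square_ideal:
  fixes d :: "'v::graded_vector_space Lambda \<Rightarrow> 'v Lambda"
  assumes odd: "\<forall>n. even n \<longrightarrow> (grade n :: 'v set) = {0}"
    and d: "cdga_differential d" and gen: "\<And>v. d (incl v) \<in> square_ideal U"
  shows "d x \<in> square_ideal U"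
proof -
  interpret d: Vector_Spaces.linear scaleQ scaleQ d
    using d by (simp add: cdga_differential_def)
  have sub: "rvs.subspace (square_ideal U)" by (simp add: square_ideal_def)
  have "d (word_product vs) \<in> square_ideal U" for vs
  proof (induction vs)
    case Nil
    show ?case using rvs.subspace_0[OF sub] by (simp add: word_product_def differential_one[OF d])
  next
    case (Cons v vs)
    have "d (word_product (v # vs)) = d (incl v) * word_product vs - incl v * d (word_product vs)"
      by (simp add: word_product_def derivation_incl[OF odd d])
    then show ?case
      using Cons gen
      by (simp add: rvs.subspace_diff[OF sub] square_ideal_mult_left square_ideal_mult_right)
  qed
  then show ?thesis
    by (induction x rule: Lambda_induct)
      (auto simp: d.add d.scale intro: rvs.subspace_add[OF sub] rvs.subspace_scale[OF sub])
qed

lemma Lambda_pow_2_span: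
  assumes "U \<subseteq> rvs.span B"
  shows "Lambda_pow 2 U \<subseteq> rvs.span {incl b * incl b' | b b'. b \<in> B \<and> b' \<in> B}"
    (is "_ \<subseteq> rvs.span ?P")
proof -
  have 1: "incl b * incl v \<in> rvs.span ?P" if "v \<in> rvs.span B" "b \<in> B" for b v
    using that(1)
  proof (induction rule: rvs.span_induct_alt)
    case (step c x y)
    have "incl b * incl x \<in> rvs.span ?P" using step(1) that(2) by (intro rvs.span_base) blast
    with step(2) show ?case
      by (simp add: incl_add incl_scale distrib_left scaleQ_mult_right rvs.span_add rvs.span_scale)
  qed (simp add: incl_zero rvs.span_zero)
  have 2: "incl u * incl v \<in> rvs.span ?P" if "v \<in> rvs.span B" "u \<in> rvs.span B" for u v
    using that(2)
  proof (induction rule: rvs.span_induct_alt)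
    case (step c x y)
    with 1[OF that(1)] show ?case
      by (simp add: incl_add incl_scale distrib_right scaleQ_mult_left rvs.span_add rvs.span_scale)
  qed (simp add: incl_zero rvs.span_zero)
  show ?thesis unfolding Lambda_pow_def
  proof (rule rvs.span_minimal)
    show "{word_product vs | vs. length vs = 2 \<and> set vs \<subseteq> U} \<subseteq> rvs.span ?P"
    proof safe
      fix vs assume vs: "length vs = 2" "set vs \<subseteq> U"
      then obtain u u' where "vs = [u, u']" by (auto simp: length_Suc_conv numeral_2_eq_2)
      then show "word_product vs \<in> rvs.span ?P"
        using vs 2 assms by (auto simp: word_product_def)
    qed
  qed simp
qed

theorem proposition7:
  fixes d :: "'v::graded_vector_space Lambda \<Rightarrow> 'v Lambda" and U W :: "'v set"
  assumes "minimal_sullivan_model d"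
    and "one_connected d"
    and "elliptic d"
    and "two_stage d U W"
    and "\<forall>n. even n \<longrightarrow> (grade n :: 'v set) = {0}"
    and "bij_betw (\<lambda>w. d (incl w)) W (Lambda_pow 2 U)"
  shows "vectorspace.dim class_ring (cohomology d) \<ge> rvs.dim (UNIV :: 'v set)"
proof -
  note odd = assms(5)
  have dga: "cdga_differential d" using assms(1) by (simp add: minimal_sullivan_model_def)
  have lin: "Vector_Spaces.linear scaleQ scaleQ d" using dga by (simp add: cdga_differential_def)
  interpret d: Vector_Spaces.linear scaleQ scaleQ d by (rule lin)
  have W: "rvs.subspace W"
    and UW: "{u + w | u w. u \<in> U \<and> w \<in> W} = UNIV" and dU: "\<And>u. u \<in> U \<Longrightarrow> d (incl u) = 0"
    using assms(4) unfolding two_stage_def graded_decomposition_def graded_subspace_def by blast+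
  obtain S :: "'v set" where S: "finite S" "rvs.span S = UNIV"
    using assms(3) unfolding elliptic_def by blast

  \<comment> \<open>A basis of \<open>V\<close> adapted to \<open>d\<close>\<close>
  obtain BU where BU: "BU \<subseteq> U" "rvs.independent BU" "U \<subseteq> rvs.span BU"
    using rvs.basis_exists[of U] by metis
  \<comment> \<open>\<open>T\<close> is a redundant spanning set of \<open>W\<close>: exchanging
    \<open>b\<close> and \<open>b'\<close> replaces an element by its negative, and
    \<open>b = b'\<close> gives zero. A basis is extracted from it below.\<close>
  define T where "T = {w \<in> W. \<exists>b\<in>BU. \<exists>b'\<in>BU. d (incl w) = incl b * incl b'}"
  have "W \<subseteq> rvs.span T"
  proof
    fix w assume "w \<in> W"
    \<comment> \<open>Surjectivity of \<open>d\<close> onto \<open>Lambda_pow 2 U\<close> lifts each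
      product \<open>b b'\<close> into \<open>T\<close>, and linearity lifts their combinations into
      the span. Injectivity on \<open>W\<close> then identifies the lift of
      \<open>d (incl w)\<close> with \<open>w\<close>.\<close>
    have "\<exists>t\<in>rvs.span T. d (incl t) = x"
      if "x \<in> rvs.span {incl b * incl b' | b b'. b \<in> BU \<and> b' \<in> BU}" for x
      using that
    proof (induction rule: rvs.span_induct_alt)
      case base
      show ?case by (intro bexI[of _ 0]) (simp_all add: incl_zero rvs.span_zero)
    next
      case (step c x y)
      then obtain b b' t where x: "x = incl b * incl b'" "b \<in> BU" "b' \<in> BU"
        and t: "t \<in> rvs.span T" "d (incl t) = y" by blast
      have "x = word_product [b, b']" by (simp add: x(1) word_product_def)
      then have "x \<in> Lambda_pow 2 U"
        unfolding Lambda_pow_def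
        using x BU(1) by (intro rvs.span_base CollectI exI[of _ "[b, b']"]) auto
      then obtain s where "s \<in> W" "x = d (incl s)"
        using assms(6) by (auto simp: bij_betw_def)
      then have "s \<in> T" "x = d (incl s)" using x unfolding T_def by auto metis
      then show ?case
        using t by (intro bexI[of _ "c *\<^sub>Q s + t"])
          (auto simp: incl_add incl_scale d.add d.scale
            intro: rvs.span_add rvs.span_scale rvs.span_base)
    qed
    moreover have "d (incl w) \<in> Lambda_pow 2 U"
      using assms(6) \<open>w \<in> W\<close> by (auto simp: bij_betw_def)
    ultimately obtain t where t: "t \<in> rvs.span T" "d (incl t) = d (incl w)"
      using Lambda_pow_2_span[OF BU(3)] by blast
    moreover have "t \<in> W"
      using t(1) rvs.span_minimal[OF _ W, of T] by (auto simp: T_def)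
    ultimately have "t = w"
      using \<open>w \<in> W\<close> assms(6) by (auto simp: bij_betw_def dest: inj_onD)
    then show "w \<in> rvs.span T" using t(1) by simp
  qed
  then have span: "v \<in> rvs.span (BU \<union> T)" for v
  proof -
    have "v \<in> {u + w | u w. u \<in> U \<and> w \<in> W}" using UW by simp
    then obtain u w where "v = u + w" "u \<in> U" "w \<in> W" by blast
    then show ?thesis
      using BU(3) \<open>W \<subseteq> rvs.span T\<close> rvs.span_mono[of BU "BU \<union> T"] rvs.span_mono[of T "BU \<union> T"]
      by (auto intro!: rvs.span_add)
  qed
  obtain B where B: "BU \<subseteq> B" "B \<subseteq> BU \<union> T" "rvs.independent B" "BU \<union> T \<subseteq> rvs.span B"
    using rvs.maximal_independent_subset_extend[OF _ BU(2), of "BU \<union> T"] by blast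
  have spanB: "rvs.span B = UNIV"
    using span rvs.span_minimal[OF B(4)] by auto
  have finB: "finite B" using rvs.independent_span_bound[OF S(1) B(3)] S(2) by simp
  \<comment> \<open>\<open>f w\<close> is a left factor of \<open>d w\<close>; the right factor need
    not be remembered, since the cocycle is \<open>f w\<close> times \<open>w\<close>.\<close>
  obtain f where f: "\<And>w. w \<in> B - BU \<Longrightarrow> f w \<in> BU"
    "\<And>w. w \<in> B - BU \<Longrightarrow> \<exists>b'. d (incl w) = incl (f w) * incl b'"
  proof -
    have "\<forall>w\<in>B - BU. \<exists>b. b \<in> BU \<and> (\<exists>b'. d (incl w) = incl b * incl b')"
      using B(2) unfolding T_def by blast
    from bchoice[OF this] show ?thesis using that by blast
  qed

  \<comment> \<open>One cocycle for each basis element\<close>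
  define \<phi> where "\<phi> e = (if e \<in> BU then incl e else incl (f e) * incl e)" for e
  have cocycle: "d (\<phi> e) = 0" if "e \<in> B" for e
  proof (cases "e \<in> BU")
    case True
    then show ?thesis using dU BU(1) by (auto simp: \<phi>_def)
  next
    case False
    then have e: "e \<in> B - BU" using that by blast
    obtain b' where "d (incl e) = incl (f e) * incl b'" using f(2)[OF e] by blast
    moreover have "d (incl (f e)) = 0" using f(1)[OF e] BU(1) dU by blast
    ultimately have "d (\<phi> e) = - (incl (f e) * (incl (f e) * incl b'))"
      using False by (simp add: \<phi>_def derivation_incl[OF odd dga])
    then show ?thesis by (simp add: incl_square_zero[OF odd] flip: mult.assoc)
  qed

  \<comment> \<open>The linear map that detects the cocycles\<close>
  let ?r = "rvs.representation B"
  have r_add: "?r (v + w) e = ?r v e + ?r w e" and r_scale: "?r (c *\<^sub>Q v) e = c * ?r v e"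
    for v w c e
    using rvs.representation_add[OF B(3)] rvs.representation_scale[OF B(3)] by (auto simp: spanB)
  have r_basis: "?r b e = (if e = b then 1 else 0)" if "b \<in> B" for b e
    using rvs.representation_basis[OF B(3) that] by auto
  have r_U: "?r u w = 0" if "u \<in> U" "w \<notin> BU" for u w
  proof -
    have "?r u = rvs.representation BU u"
      using BU(3) that(1) by (intro rvs.representation_extend[OF B(3) _ B(1)]) blast
    then show ?thesis using that(2) rvs.representation_ne_zero[of BU u w] by auto
  qed
  \<comment> \<open>\<alpha> is the projection of \<open>V\<close> onto \<open>U\<close> along the
    span of \<open>B - BU\<close>. The coefficient of \<open>e\<close> in \<beta> is the alternating
    form given by the two-by-two minor of the coordinates \<open>f e\<close> and
    \<open>e\<close>.\<close>
  define \<alpha> where "\<alpha> v = (\<Sum>e\<in>BU. ?r v e *\<^sub>Q e)" for v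
  define \<beta> where "\<beta> v w = (\<Sum>e\<in>B - BU. (?r v (f e) * ?r w e - ?r w (f e) * ?r v e) *\<^sub>Q e)" for v w
  have \<beta>_add_right: "\<beta> v (w + w') = \<beta> v w + \<beta> v w'" for v w w'
    unfolding \<beta>_def r_add sum.distrib[symmetric] scaleQ_add_left[symmetric]
    by (simp add: algebra_simps)
  have \<beta>_add_left: "\<beta> (v + v') w = \<beta> v w + \<beta> v' w" for v v' w
    unfolding \<beta>_def r_add sum.distrib[symmetric] scaleQ_add_left[symmetric]
    by (simp add: algebra_simps)
  have \<beta>_scale_right: "\<beta> v (c *\<^sub>Q w) = c *\<^sub>Q \<beta> v w" for c v w
    unfolding \<beta>_def r_scale rvs.scale_sum_right scaleQ_scaleQ by (simp add: algebra_simps)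
  have \<beta>_scale_left: "\<beta> (c *\<^sub>Q v) w = c *\<^sub>Q \<beta> v w" for c v w
    unfolding \<beta>_def r_scale rvs.scale_sum_right scaleQ_scaleQ by (simp add: algebra_simps)
  have \<beta>_sym: "\<beta> v w = koszul_sign m n *\<^sub>Q \<beta> w v" if "v \<in> grade m" "w \<in> grade n" for v w m n
  proof (cases "odd m \<and> odd n")
    case True
    then show ?thesis
      by (simp add: koszul_sign_def \<beta>_def rvs.scale_sum_right flip: sum_negf)
  next
    case False
    then have "v = 0 \<or> w = 0" using that odd by blast
    then show ?thesis by (auto simp: \<beta>_def rvs.representation_zero)
  qed
  obtain F where F: "Vector_Spaces.linear scaleQ scaleQ F"
    "\<And>v. F (incl v) = \<alpha> v" "\<And>v w. F (incl v * incl w) = \<beta> v w"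
    "\<And>vs. length vs > 2 \<Longrightarrow> F (word_product vs) = 0"
  proof (rule Lambda_linear_extension_short[of \<alpha> \<beta>])
    show "Vector_Spaces.linear scaleQ scaleQ \<alpha>"
      by unfold_locales (simp_all add: \<alpha>_def r_add r_scale scaleQ_add_left sum.distrib
        rvs.scale_sum_right scaleQ_scaleQ)
    show "Vector_Spaces.linear scaleQ scaleQ (\<beta> v)" for v
      by unfold_locales (rule \<beta>_add_right, rule \<beta>_scale_right)
    show "Vector_Spaces.linear scaleQ scaleQ (\<lambda>v. \<beta> v w)" for w
      by unfold_locales (rule \<beta>_add_left, rule \<beta>_scale_left)
  qed (rule \<beta>_sym that; assumption)+
  interpret F: Vector_Spaces.linear scaleQ scaleQ F by (rule F(1))
  \<comment> \<open>With empty outer words, each minor in \<open>\<beta> u u'\<close> has a factor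
    of coordinate \<open>e\<close> outside \<open>BU\<close>, which vanishes on \<open>U\<close>.
    Otherwise the wordlength exceeds two, where \<open>F\<close> is zero.\<close>
  have F_ideal: "F x = 0" if "x \<in> square_ideal U" for x
    using that unfolding square_ideal_def
  proof (induction rule: rvs.span_induct_alt)
    case (step c x y)
    from step(1) obtain xs u u' ys
      where x: "x = word_product xs * (incl u * incl u') * word_product ys" and u: "u \<in> U" "u' \<in> U"
      by blast
    have "F x = 0"
    proof (cases "xs = [] \<and> ys = []")
      case True
      then have "F x = \<beta> u u'" by (simp add: x word_product_def F(3))
      then show ?thesis using u by (simp add: \<beta>_def r_U)
    next
      case False
      have "x = word_product (xs @ [u, u'] @ ys)"
        by (simp add: x word_product_def mult.assoc)
      then show ?thesis using False F(4)[of "xs @ [u, u'] @ ys"] by (cases xs; cases ys) auto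
    qed
    with step(2) show ?case by (simp add: F.add F.scale)
  qed simp
  have F_boundary: "F (d x) = 0" for x
  proof (rule F_ideal, rule range_differential_subset_square_ideal[OF odd dga])
    fix v
    have "v \<in> {u + w | u w. u \<in> U \<and> w \<in> W}" using UW by simp
    then obtain u w where v: "v = u + w" "u \<in> U" "w \<in> W" by blast
    then have "d (incl v) = d (incl w)" by (simp add: incl_add d.add dU)
    then show "d (incl v) \<in> square_ideal U"
      using assms(6) \<open>w \<in> W\<close> Lambda_pow_2_subset_square_ideal by (auto simp: bij_betw_def)
  qed
  have F_\<phi>: "F (\<phi> e) = e" if "e \<in> B" for e
  proof (cases "e \<in> BU")
    case True
    have "finite BU" using finB B(1) finite_subset by blast
    then show ?thesis
      using True that
      by (simp add: \<phi>_def F(2) \<alpha>_def r_basis if_distrib[of "\<lambda>c. c *\<^sub>Q _"] scaleQ_one cong: if_cong)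
  next
    case False
    then have e: "e \<in> B - BU" using that by blast
    have fe: "f e \<in> B" using f(1)[OF e] B(1) by blast
    \<comment> \<open>The subtracted product vanishes because \<open>f e'\<close> lies in
      \<open>BU\<close> while \<open>e\<close> does not. In the first product \<open>?r e e'\<close>
      forces \<open>e' = e\<close>, so \<open>f\<close> may take the same value at several basis
      elements.\<close>
    have "(?r (f e) (f e') * ?r e e' - ?r e (f e') * ?r (f e) e') *\<^sub>Q e' = (if e' = e then e else 0)"
      if "e' \<in> B - BU" for e'
    proof -
      have "f e' \<noteq> e" "f e \<noteq> e'" using f(1) e that by auto
      then show ?thesis using \<open>e \<in> B\<close> fe by (simp add: r_basis scaleQ_one)
    qed
    then have "\<beta> (f e) e = (\<Sum>e'\<in>B - BU. if e' = e then e else 0)"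
      unfolding \<beta>_def by (intro sum.cong) auto
    also have "\<dots> = e" using e finB by simp
    finally show ?thesis using False by (simp add: \<phi>_def F(3))
  qed

  \<comment> \<open>Counting the independent classes\<close>
  have image: "F ` \<phi> ` B = B" using F_\<phi> by (force simp: image_iff)
  have "rvs.dim (UNIV :: 'v set) = card B"
    using rvs.dim_eq_card[of B UNIV] spanB B(3) by simp
  also have "\<dots> = card (\<phi> ` B)" using F_\<phi> by (metis card_image inj_onI)
  also have "\<dots> \<le> vectorspace.dim class_ring (cohomology d)"
  proof (rule dim_cohomology_ge_card[OF lin _ F(1) F_boundary])
    show "vectorspace.fin_dim class_ring (cohomology d)" using assms(3) by (simp add: elliptic_def)
    show "inj_on F (\<phi> ` B)" by (auto intro!: inj_onI simp: F_\<phi>)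
  qed (auto simp: cocycle image B(3))
  finally show ?thesis .
qed

end
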